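(* Let $p,q$ be positive integers. The exponential map $\exp:\mathfrak{u}_{p,q}\to U(p,q)$ is surjective.
   Context: Let $n=p+q$ and $I_{p,q}=\begin{pmatrix} I_p&0\\0&-I_q\end{pmatrix}$. The indefinite unitary group is $U(p,q)=\{\mathcal{A}\in GL(n,\mathbb{C}):\mathcal{A}^*I_{p,q}\mathcal{A}=I_{p,q}\}$, where $*$ is conjugate transpose, and its Lie algebra is $\mathfrak{u}_{p,q}=\{X\in M_n(\mathbb{C}):X^*I_{p,q}+I_{p,q}X=0\}$. The exponential map is the matrix exponential. *)

theory Defs
  imports "HOL-Analysis.Analysis"
begin

definition conj_transpose :: "complex^'n^'m \<Rightarrow> complex^'m^'n"
  where "conj_transpose A = map_matrix cnj (transpose A)"

primrec matrix_power :: "complex^'n^'n \<Rightarrow> nat \<Rightarrow> complex^'n^'n"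
  where
    "matrix_power A 0 = mat 1"
  | "matrix_power A (Suc k) = A ** matrix_power A k"

text \<open>
  The library function \<^const>\<open>exp\<close> is not usable here: multiplication on the type
  \<open>complex^'n^'n\<close> is componentwise.  The series below converges for every matrix,
  see \<open>matrix_exp_sums\<close>.
\<close>

definition matrix_exp :: "complex^'n^'n \<Rightarrow> complex^'n^'n"
  where "matrix_exp A = (\<Sum>k. inverse (fact k) *\<^sub>R matrix_power A k)"

text \<open>
  The integers \<open>p\<close>, \<open>q\<close> are the cardinalities of the finite (nonempty) index types \<open>'p\<close>, \<open>'q\<close>;
  rows and columns of an \<open>n \<times> n\<close> matrix with \<open>n = p + q\<close> are indexed by the disjoint sum
  \<open>'p + 'q\<close>, the summands being the two diagonal blocks.
\<close>

definition signature_matrix :: "complex^('p::finite + 'q::finite)^('p + 'q)"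
  where "signature_matrix =
    (\<chi> i j. case (i, j) of
        (Inl a, Inl b) \<Rightarrow> mat 1 $ a $ b
      | (Inr a, Inr b) \<Rightarrow> - (mat 1 $ a $ b)
      | _ \<Rightarrow> 0)"

definition indefinite_unitary_group :: "(complex^('p::finite + 'q::finite)^('p + 'q)) set"
  where "indefinite_unitary_group =
    {A. invertible A \<and> conj_transpose A ** signature_matrix ** A = signature_matrix}"

definition indefinite_unitary_algebra :: "(complex^('p::finite + 'q::finite)^('p + 'q)) set"
  where "indefinite_unitary_algebra =
    {X. conj_transpose X ** signature_matrix + signature_matrix ** X = 0}"

lemma norm_matrix_power_entry_le:
  fixes A :: "complex^'n^'n"
  shows "norm (matrix_power A k $ i $ j) \<le> (\<Sum>a\<in>UNIV. \<Sum>b\<in>UNIV. norm (A $ a $ b)) ^ k"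
proof (induction k arbitrary: i j)
  case 0
  then show ?case by (simp add: mat_def)
next
  case (Suc k)
  let ?K = "\<Sum>a\<in>UNIV. \<Sum>b\<in>UNIV. norm (A $ a $ b)"
  have K0: "0 \<le> ?K" by (intro sum_nonneg) auto
  have row: "(\<Sum>l\<in>UNIV. norm (A $ i $ l)) \<le> ?K"
    by (rule member_le_sum[where f = "\<lambda>a. \<Sum>b\<in>UNIV. norm (A $ a $ b)"])
      (auto intro: sum_nonneg)
  have "norm (matrix_power A (Suc k) $ i $ j)
      \<le> (\<Sum>l\<in>UNIV. norm (A $ i $ l * matrix_power A k $ l $ j))"
    by (simp add: matrix_matrix_mult_def norm_sum)
  also have "\<dots> \<le> (\<Sum>l\<in>UNIV. norm (A $ i $ l) * ?K ^ k)"
    unfolding norm_mult by (intro sum_mono mult_left_mono Suc.IH) auto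
  also have "\<dots> = (\<Sum>l\<in>UNIV. norm (A $ i $ l)) * ?K ^ k"
    by (simp add: sum_distrib_right)
  also have "\<dots> \<le> ?K * ?K ^ k"
    by (intro mult_right_mono row zero_le_power K0)
  finally show ?case by simp
qed

lemma matrix_exp_sums:
  fixes A :: "complex^'n^'n"
  shows "(\<lambda>k. inverse (fact k) *\<^sub>R matrix_power A k) sums matrix_exp A"
proof -
  let ?K = "\<Sum>a\<in>UNIV. \<Sum>b\<in>UNIV. norm (A $ a $ b)"
  let ?C = "real CARD('n) * real CARD('n)"
  have bound: "norm (inverse (fact k) *\<^sub>R matrix_power A k) \<le> ?C * (inverse (fact k) * ?K ^ k)" for k
  proof -
    have "norm (matrix_power A k) \<le> (\<Sum>i\<in>UNIV. norm (matrix_power A k $ i))"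
      unfolding norm_vec_def[of "matrix_power A k"] by (rule L2_set_le_sum) auto
    also have "\<dots> \<le> (\<Sum>i\<in>UNIV. \<Sum>j\<in>UNIV. norm (matrix_power A k $ i $ j))"
    proof (rule sum_mono)
      fix i
      show "norm (matrix_power A k $ i) \<le> (\<Sum>j\<in>UNIV. norm (matrix_power A k $ i $ j))"
        unfolding norm_vec_def[of "matrix_power A k $ i"] by (rule L2_set_le_sum) auto
    qed
    also have "\<dots> \<le> (\<Sum>i\<in>(UNIV::'n set). \<Sum>j\<in>(UNIV::'n set). ?K ^ k)"
      by (intro sum_mono norm_matrix_power_entry_le)
    also have "\<dots> = ?C * ?K ^ k" by simp
    finally have le: "norm (matrix_power A k) \<le> ?C * ?K ^ k" .
    have "norm (inverse (fact k) *\<^sub>R matrix_power A k) = inverse (fact k) * norm (matrix_power A k)"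
      by simp
    also have "\<dots> \<le> inverse (fact k) * (?C * ?K ^ k)"
      by (rule mult_left_mono[OF le]) simp
    finally show ?thesis by (simp only: mult_ac)
  qed
  have "summable (\<lambda>k. ?C * (inverse (fact k) * ?K ^ k))"
    by (intro summable_mult summable_exp)
  then have "summable (\<lambda>k. inverse (fact k) *\<^sub>R matrix_power A k)"
    by (rule summable_comparison_test[rotated]) (use bound in blast)
  then show ?thesis
    unfolding matrix_exp_def by (rule summable_sums)
qed

end

theory Submission
  imports Defs
begin

text \<open>
  If no eigenvalue of \<open>B\<close> lies in \<open>(-\<infinity>, 0]\<close>, then \<open>L = \<integral>\<^sub>0\<^sup>1 (B - 1) (1 + t (B - 1))\<inverse> dt\<close> is a logarithm of
  \<open>B\<close>.  For \<open>B\<^sup>* J B = J\<close> the integrand \<open>F\<close> satisfies \<open>F(t)\<^sup>* J + J F(1 - t) = 0\<close>, so the substitution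
  \<open>t \<mapsto> 1 - t\<close> yields \<open>L\<^sup>* J + J L = 0\<close>.  A general \<open>A\<close> in the group is first multiplied by a scalar
  \<open>cis \<theta>\<close> that rotates its finitely many eigenvalues off the negative real axis; since \<open>\<i> \<theta>\<close> lies in the
  Lie algebra and is central, it can be subtracted from the logarithm afterwards.
\<close>

section \<open>Bounded endomorphisms as a Banach algebra\<close>

text \<open>A copy of the bounded operators on which \<open>*\<close> can be composition, so that
  \<open>exp\<close> becomes the operator exponential.\<close>

typedef (overloaded) ('a::real_normed_vector) endo = "UNIV :: ('a \<Rightarrow>\<^sub>L 'a) set"
  morphisms blinfun_of_endo endo_of_blinfun
  by simp

setup_lifting type_definition_endo

lemma endo_eqI:
  "(\<And>v. blinfun_apply (blinfun_of_endo x) v = blinfun_apply (blinfun_of_endo y) v) \<Longrightarrow> x = y"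
  by (simp add: blinfun_of_endo_inject[symmetric] blinfun_eqI)

text \<open>The sort \<open>perfect_space\<close> excludes the zero space, so that the identity has
  norm 1 and differs from 0.\<close>

instantiation endo :: ("{real_normed_vector, perfect_space}") real_normed_algebra_1
begin

lift_definition zero_endo :: "'a endo" is 0 .
lift_definition one_endo :: "'a endo" is id_blinfun .
lift_definition plus_endo :: "'a endo \<Rightarrow> 'a endo \<Rightarrow> 'a endo" is "(+)" .
lift_definition minus_endo :: "'a endo \<Rightarrow> 'a endo \<Rightarrow> 'a endo" is "(-)" .
lift_definition uminus_endo :: "'a endo \<Rightarrow> 'a endo" is uminus .
lift_definition times_endo :: "'a endo \<Rightarrow> 'a endo \<Rightarrow> 'a endo" is "(o\<^sub>L)" .
lift_definition scaleR_endo :: "real \<Rightarrow> 'a endo \<Rightarrow> 'a endo" is "(*\<^sub>R)" .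
lift_definition norm_endo :: "'a endo \<Rightarrow> real" is norm .
lift_definition dist_endo :: "'a endo \<Rightarrow> 'a endo \<Rightarrow> real" is dist .
lift_definition sgn_endo :: "'a endo \<Rightarrow> 'a endo" is sgn .

definition uniformity_endo :: "('a endo \<times> 'a endo) filter"
  where "uniformity_endo = (INF e\<in>{0<..}. principal {(x, y). dist x y < e})"

definition open_endo :: "'a endo set \<Rightarrow> bool"
  where "open_endo U \<longleftrightarrow> (\<forall>x\<in>U. \<forall>\<^sub>F (x', y) in uniformity. x' = x \<longrightarrow> y \<in> U)"

instance
proof
  show "(0::'a endo) \<noteq> 1"
  proof
    assume "(0::'a endo) = 1"
    then have "norm (0 :: 'a \<Rightarrow>\<^sub>L 'a) = norm (id_blinfun :: 'a \<Rightarrow>\<^sub>L 'a)"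
      by transfer simp
    then show False by simp
  qed
  show "uniformity = (INF e\<in>{0<..}. principal {(x, y :: 'a endo). dist x y < e})"
    by (fact uniformity_endo_def)
  show "open U \<longleftrightarrow> (\<forall>x\<in>U. \<forall>\<^sub>F (x', y) in uniformity. x' = x \<longrightarrow> y \<in> U)" for U :: "'a endo set"
    by (fact open_endo_def)
qed (transfer; simp add: algebra_simps dist_norm sgn_div_norm norm_triangle_ineq
      norm_blinfun_compose blinfun_eqI blinfun.bilinear_simps)+

end

instance endo :: ("{banach, perfect_space}") banach
proof
  fix X :: "nat \<Rightarrow> 'a endo"
  assume "Cauchy X"
  then have "Cauchy (\<lambda>n. blinfun_of_endo (X n))"
    by (simp add: Cauchy_def dist_endo.rep_eq)
  then obtain y where "(\<lambda>n. blinfun_of_endo (X n)) \<longlonglongrightarrow> y"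
    using Cauchy_convergent convergent_def by blast
  then have "X \<longlonglongrightarrow> endo_of_blinfun y"
    by (simp add: tendsto_iff dist_endo.rep_eq endo_of_blinfun_inverse)
  then show "convergent X"
    by (auto simp: convergent_def)
qed


section \<open>Logarithms in Banach algebras\<close>

text \<open>Termwise comparison with the real exponential series. The quadratic bound makes the
  identity map the derivative of \<open>exp\<close> at 0.\<close>

lemma norm_exp_remainder_le:
  fixes x :: "'a::{real_normed_algebra_1, banach}"
  assumes "norm x \<le> 1"
  shows "norm (exp x - 1 - x) \<le> (norm x)\<^sup>2"
proof -
  have "norm (exp x - 1 - x) = norm (\<Sum>n. inverse (fact (n + 2)) *\<^sub>R (x ^ (n + 2)))"
    using exp_first_two_terms[of x] by simp
  also have "\<dots> \<le> (\<Sum>n. inverse (fact (n + 2)) *\<^sub>R (norm x ^ (n + 2)))"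
  proof (rule norm_suminf_le)
    show "norm (inverse (fact (n + 2)) *\<^sub>R x ^ (n + 2)) \<le> inverse (fact (n + 2)) *\<^sub>R norm x ^ (n + 2)" for n
      using norm_power_ineq[of x "n + 2"] by (simp del: power_Suc add: divide_simps)
    show "summable (\<lambda>n. inverse (fact (n + 2)) *\<^sub>R norm x ^ (n + 2))"
      using summable_ignore_initial_segment[OF summable_exp_generic[of "norm x"], of 2] by simp
  qed
  also have "\<dots> = exp (norm x) - 1 - norm x"
    using exp_first_two_terms[of "norm x"] by simp
  also have "\<dots> \<le> (norm x)\<^sup>2"
    using exp_bound[of "norm x"] assms by simp
  finally show ?thesis .
qed

lemma exp_has_derivative_at_0:
  "(exp has_derivative (\<lambda>h. h)) (at (0::'a::{real_normed_algebra_1, banach}))"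
  unfolding has_derivative_at
proof
  show "bounded_linear (\<lambda>h::'a. h)"
    by (rule bounded_linear_ident)
  show "(\<lambda>h::'a. norm (exp (0 + h) - exp 0 - h) / norm h) \<midarrow>0\<rightarrow> 0"
  proof (rule Lim_null_comparison)
    show "(\<lambda>h::'a. norm h) \<midarrow>0\<rightarrow> 0"
      by (auto intro!: tendsto_eq_intros)
    have "\<forall>\<^sub>F h::'a in at 0. norm h \<le> 1"
      unfolding eventually_at by (intro exI[of _ 1]) auto
    then show "\<forall>\<^sub>F h::'a in at 0. norm (norm (exp (0 + h) - exp 0 - h) / norm h) \<le> norm h"
    proof eventually_elim
      case (elim h)
      then show ?case
        using norm_exp_remainder_le[of h] by (auto simp: divide_simps power2_eq_square)
    qed
  qed
qed

text \<open>Commutation gives \<open>exp (L t) = exp (L t - L s) * exp (L s)\<close>, so the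
  derivative of \<open>exp\<close> at 0 is the only one needed.\<close>

lemma has_vector_derivative_exp_commuting:
  fixes L :: "real \<Rightarrow> 'a::{real_normed_algebra_1, banach}"
  assumes L: "(L has_vector_derivative L') (at s within S)" and "s \<in> S"
    and comm: "\<And>t. t \<in> S \<Longrightarrow> L t * L s = L s * L t"
  shows "((\<lambda>t. exp (L t)) has_vector_derivative L' * exp (L s)) (at s within S)"
proof -
  have "((\<lambda>t. L t - L s) has_vector_derivative L') (at s within S)"
    using L by (auto intro!: derivative_eq_intros)
  then have "((\<lambda>t. L t - L s) has_derivative (\<lambda>h. h *\<^sub>R L')) (at s within S)"
    by (simp add: has_vector_derivative_def)
  from has_derivative_compose[OF this, of exp "\<lambda>h. h"] exp_has_derivative_at_0
  have "((\<lambda>t. exp (L t - L s)) has_vector_derivative L') (at s within S)"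
    by (simp add: has_vector_derivative_def)
  then have "((\<lambda>t. exp (L t - L s) * exp (L s)) has_vector_derivative L' * exp (L s)) (at s within S)"
    by (rule has_vector_derivative_mult_left)
  then show ?thesis
  proof (rule has_vector_derivative_transform[OF \<open>s \<in> S\<close>, rotated])
    fix t assume "t \<in> S"
    then have "(L t - L s) * L s = L s * (L t - L s)"
      by (simp add: comm algebra_simps)
    then show "exp (L t) = exp (L t - L s) * exp (L s)"
      by (simp add: exp_add_commuting[symmetric])
  qed
qed

text \<open>The relation passes to all powers and then to the series. With \<open>x = y\<close> it
  yields commutation with \<open>exp x\<close>; with \<open>y = - X\<close> it turns skewness into
  the isometry condition.\<close>

lemma exp_intertwine:
  fixes x y z :: "'a::{real_normed_algebra_1, banach}"
  assumes "x * z = z * y"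
  shows "exp x * z = z * exp y"
proof -
  have pow: "x ^ n * z = z * y ^ n" for n
  proof (induction n)
    case (Suc n)
    have "x ^ Suc n * z = x * (x ^ n * z)"
      by (simp add: mult.assoc)
    also have "\<dots> = (x * z) * y ^ n"
      unfolding Suc.IH by (rule mult.assoc[symmetric])
    also have "\<dots> = z * y ^ Suc n"
      by (simp add: assms mult.assoc)
    finally show ?case .
  qed simp
  have "(\<lambda>n. x ^ n /\<^sub>R fact n * z) sums (exp x * z)"
    using exp_converges by (rule sums_mult2)
  moreover have "(\<lambda>n. z * (y ^ n /\<^sub>R fact n)) sums (z * exp y)"
    using exp_converges by (rule sums_mult)
  ultimately show ?thesis
    by (simp add: pow sums_unique2)
qed

lemma commute_with_inverse:
  fixes c x y :: "'a::ring_1"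
  assumes "c * x = x * c" "x * y = 1" "y * x = 1"
  shows "c * y = y * c"
proof -
  have "c * y = y * x * c * y"
    by (simp add: assms)
  also have "\<dots> = y * c * (x * y)"
    using assms(1) by (simp add: mult.assoc) (simp add: mult.assoc[symmetric])
  finally show ?thesis
    by (simp add: assms)
qed

text \<open>Rests on \<open>r t - r s = r t * (u s - u t) * r s\<close>, once \<open>r t\<close> is
  known to be bounded near \<open>s\<close>.\<close>

lemma continuous_on_inverse_banach_algebra:
  fixes u r :: "'b::topological_space \<Rightarrow> 'a::real_normed_algebra_1"
  assumes u: "continuous_on S u"
    and inv: "\<And>t. t \<in> S \<Longrightarrow> u t * r t = 1" "\<And>t. t \<in> S \<Longrightarrow> r t * u t = 1"
  shows "continuous_on S r"
  unfolding continuous_on_def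
proof
  fix s assume s: "s \<in> S"
  have lim: "((\<lambda>t. norm (u t - u s)) \<longlongrightarrow> 0) (at s within S)"
    using u s unfolding continuous_on_def by (intro tendsto_norm_zero LIM_zero) blast
  then have "((\<lambda>t. norm (u t - u s) * norm (r s)) \<longlongrightarrow> 0) (at s within S)"
    by (rule tendsto_mult_left_zero)
  \<comment> \<open>With the bound 1/2 the difference \<open>r t - r s\<close> has at most half the
    norm of \<open>r t\<close>, whence \<open>norm (r t) \<le> 2 * norm (r s)\<close>.\<close>
  then have "\<forall>\<^sub>F t in at s within S. norm (u t - u s) * norm (r s) < 1 / 2"
    by (rule order_tendstoD) simp
  moreover have "\<forall>\<^sub>F t in at s within S. t \<in> S"
    by (simp add: eventually_at_filter)
  ultimately have "\<forall>\<^sub>F t in at s within S. norm (r t - r s) \<le> 2 * norm (r s) * norm (r s) * norm (u t - u s)"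
  proof eventually_elim
    case (elim t)
    have eq: "r t - r s = r t * (u s - u t) * r s"
      using inv[OF s] inv[OF elim(2)] by (simp add: algebra_simps)
    have le: "norm (r t - r s) \<le> norm (r t) * (norm (u t - u s) * norm (r s))"
      unfolding eq using norm_mult_ineq[of "r t * (u s - u t)" "r s"] norm_mult_ineq[of "r t" "u s - u t"]
      by (smt (verit) mult.assoc mult_right_mono norm_ge_zero norm_minus_commute)
    also have "\<dots> \<le> norm (r t) * (1 / 2)"
      using elim(1) by (intro mult_left_mono) auto
    finally have "norm (r t) \<le> 2 * norm (r s)"
      using norm_triangle_ineq2[of "r t" "r s"] by linarith
    then have "norm (r t) * (norm (u t - u s) * norm (r s)) \<le> 2 * norm (r s) * (norm (u t - u s) * norm (r s))"
      by (intro mult_right_mono) auto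
    with le show ?case
      by (simp add: mult_ac)
  qed
  moreover have "((\<lambda>t. 2 * norm (r s) * norm (r s) * norm (u t - u s)) \<longlongrightarrow> 0) (at s within S)"
    using lim by (rule tendsto_mult_right_zero)
  ultimately have "((\<lambda>t. r t - r s) \<longlongrightarrow> 0) (at s within S)"
    by (rule Lim_null_comparison)
  then show "(r \<longlongrightarrow> r s) (at s within S)"
    by (rule LIM_zero_cancel)
qed

text \<open>Let \<open>L s\<close> be the integral up to \<open>s\<close>. The product
  \<open>exp (- L s) * (1 + s *\<^sub>R (a - 1))\<close> has derivative 0; it equals 1 at
  \<open>s = 0\<close> and \<open>exp (- L 1) * a\<close> at \<open>s = 1\<close>.\<close>

lemma exp_integral_resolvent:
  fixes a :: "'a::{real_normed_algebra_1, banach}" and r :: "real \<Rightarrow> 'a"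
  assumes inv: "\<And>t. t \<in> {0..1} \<Longrightarrow> (1 + t *\<^sub>R (a - 1)) * r t = 1"
      "\<And>t. t \<in> {0..1} \<Longrightarrow> r t * (1 + t *\<^sub>R (a - 1)) = 1"
  shows "exp (integral {0..1} (\<lambda>t. (a - 1) * r t)) = a"
proof -
  define b where "b = a - 1"
  define L where "L s = integral {0..s} (\<lambda>t. b * r t)" for s
  note inv' = inv[folded b_def]
  have "continuous_on {0..1} r"
    by (rule continuous_on_inverse_banach_algebra[OF _ inv]) (intro continuous_intros)
  then have cont: "continuous_on {0..1} (\<lambda>t. b * r t)"
    by (intro continuous_intros)
  have int: "(\<lambda>t. b * r t) integrable_on {0..s}" if "s \<in> {0..1}" for s
    by (rule integrable_continuous_real, rule continuous_on_subset[OF cont]) (use that in auto)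
  \<comment> \<open>Multiplication by \<open>c\<close> on either side is bounded linear and moves
    under the integral, so commutation with the integrand suffices. Applied below to
    \<open>b\<close>, to \<open>r t\<close> and finally to \<open>L t\<close> itself.\<close>
  have comm_L: "c * L s = L s * c" if "s \<in> {0..1}" "c * b = b * c"
    "\<And>t. t \<in> {0..1} \<Longrightarrow> c * r t = r t * c" for c s
  proof -
    have "c * L s = integral {0..s} (\<lambda>t. c * (b * r t))"
      unfolding L_def using integral_linear[OF int[OF that(1)] bounded_linear_mult_right[of c]]
      by (simp add: o_def)
    also have "\<dots> = integral {0..s} (\<lambda>t. b * r t * c)"
      by (rule integral_cong) (use that in \<open>metis (no_types, opaque_lifting) atLeastAtMost_iff mult.assoc order_trans\<close>)
    also have "\<dots> = L s * c"
      unfolding L_def using integral_linear[OF int[OF that(1)] bounded_linear_mult_left[of c]]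
      by (simp add: o_def)
    finally show ?thesis .
  qed
  have comm_r: "c * r t = r t * c" if "t \<in> {0..1}" "c * b = b * c" for c t
    by (rule commute_with_inverse[OF _ inv'[OF that(1)]]) (simp add: algebra_simps that(2))
  have b_r: "b * r t = r t * b" if "t \<in> {0..1}" for t
    by (rule comm_r[OF that refl])
  have r_r: "r s * r t = r t * r s" if "s \<in> {0..1}" "t \<in> {0..1}" for s t
    by (rule comm_r[OF that(2) b_r[OF that(1), symmetric]])
  have b_L: "b * L s = L s * b" if "s \<in> {0..1}" for s
    using that by (intro comm_L b_r) auto
  have r_L: "r t * L s = L s * r t" if "s \<in> {0..1}" "t \<in> {0..1}" for s t
    using that by (intro comm_L r_r b_r[symmetric]) auto
  have L_L: "L t * L s = L s * L t" if "s \<in> {0..1}" "t \<in> {0..1}" for s t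
    using that by (intro comm_L b_L[symmetric] r_L[symmetric]) auto
  have L': "(L has_vector_derivative b * r s) (at s within {0..1})" if "s \<in> {0..1}" for s
    unfolding L_def by (rule integral_has_vector_derivative[OF cont that])
  have "((\<lambda>s. exp (- L s) * (1 + s *\<^sub>R b)) has_vector_derivative 0) (at s within {0..1})"
    if s: "s \<in> {0..1}" for s
  proof -
    have E: "((\<lambda>s. exp (- L s)) has_vector_derivative (- (b * r s)) * exp (- L s)) (at s within {0..1})"
      by (rule has_vector_derivative_exp_commuting[OF has_vector_derivative_minus[OF L'[OF s]] s])
        (use L_L s in auto)
    have c: "b * exp (- L s) = exp (- L s) * b" "r s * exp (- L s) = exp (- L s) * r s"
      using exp_intertwine[of "- L s" b "- L s"] exp_intertwine[of "- L s" "r s" "- L s"] b_L[OF s] r_L[OF s s]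
      by simp_all
    \<comment> \<open>This is the product-rule derivative: after commuting, \<open>r s\<close>
      cancels its inverse \<open>1 + s *\<^sub>R b\<close>.\<close>
    have z: "exp (- L s) * b + (- (b * r s)) * exp (- L s) * (1 + s *\<^sub>R b) = 0"
    proof -
      have "(b * r s) * exp (- L s) * (1 + s *\<^sub>R b) = exp (- L s) * b * (r s * (1 + s *\<^sub>R b))"
        by (metis c mult.assoc)
      then show ?thesis
        by (simp add: inv'[OF s])
    qed
    have "((\<lambda>s. 1 + s *\<^sub>R b) has_vector_derivative b) (at s within {0..1})"
      by (auto intro!: derivative_eq_intros)
    from has_vector_derivative_mult[OF E this] show ?thesis
      by (simp only: z)
  qed
  then obtain c where c: "\<And>s. s \<in> {0..1} \<Longrightarrow> exp (- L s) * (1 + s *\<^sub>R b) = c"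
    using has_vector_derivative_zero_constant[of "{0..1::real}" "\<lambda>s. exp (- L s) * (1 + s *\<^sub>R b)"]
    by auto
  have "exp (- L 1) * a = 1"
    using c[of 0] c[of 1] by (simp add: L_def b_def)
  then have "exp (L 1) * (exp (- L 1) * a) = exp (L 1)"
    by simp
  then have "a = exp (L 1)"
    by (simp add: mult.assoc[symmetric] exp_minus_inverse)
  then show ?thesis
    by (simp add: L_def b_def)
qed


section \<open>Matrices as endomorphisms\<close>

text \<open>An injective algebra homomorphism: matrix identities are proved on its image, where ring
  simplification and the Banach algebra \<open>exp\<close> apply.\<close>

definition endo_of_matrix :: "complex^'n^'n \<Rightarrow> (complex^'n) endo"
  where "endo_of_matrix A = endo_of_blinfun (Blinfun ((*v) A))"

lemma apply_endo_of_matrix [simp]: "blinfun_apply (blinfun_of_endo (endo_of_matrix A)) v = A *v v"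
  by (simp add: endo_of_matrix_def endo_of_blinfun_inverse bounded_linear_Blinfun_apply)

lemma scaleR_matrix_vector_mult:
  fixes A :: "complex^'n^'m"
  shows "(r *\<^sub>R A) *v v = r *\<^sub>R (A *v v)"
  by (simp add: matrix_vector_mult_def vec_eq_iff scaleR_sum_right)

lemma endo_of_matrix_hom:
  "endo_of_matrix (A + B) = endo_of_matrix A + endo_of_matrix B"
  "endo_of_matrix (A - B) = endo_of_matrix A - endo_of_matrix B"
  "endo_of_matrix (A ** B) = endo_of_matrix A * endo_of_matrix B"
  "endo_of_matrix (r *\<^sub>R A) = r *\<^sub>R endo_of_matrix A"
  "endo_of_matrix (mat 1) = 1"
  "endo_of_matrix 0 = 0"
  by (rule endo_eqI;
      simp add: plus_endo.rep_eq minus_endo.rep_eq times_endo.rep_eq scaleR_endo.rep_eq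
        one_endo.rep_eq zero_endo.rep_eq blinfun.bilinear_simps algebra_simps
        matrix_vector_mul_assoc scaleR_matrix_vector_mult)+

lemma endo_of_matrix_inject: "endo_of_matrix A = endo_of_matrix B \<longleftrightarrow> A = B"
  by (metis apply_endo_of_matrix matrix_eq)

lemma bounded_linear_endo_of_matrix: "bounded_linear endo_of_matrix"
  by (simp add: linear_conv_bounded_linear[symmetric] linear_iff endo_of_matrix_hom)

lemma endo_of_matrix_power: "endo_of_matrix (matrix_power A k) = endo_of_matrix A ^ k"
  by (induction k) (simp_all add: endo_of_matrix_hom)

lemma endo_of_matrix_exp: "endo_of_matrix (matrix_exp A) = exp (endo_of_matrix A)"
proof -
  have "(\<lambda>k. endo_of_matrix A ^ k /\<^sub>R fact k) sums endo_of_matrix (matrix_exp A)"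
    using bounded_linear.sums[OF bounded_linear_endo_of_matrix matrix_exp_sums[of A]]
    by (simp add: endo_of_matrix_hom endo_of_matrix_power)
  with exp_converges show ?thesis
    by (rule sums_unique2[symmetric])
qed

text \<open>An entry is a coordinate of the image of a unit vector. Hence operator convergence
  forces entrywise convergence.\<close>

lemma norm_matrix_entry_le: "norm (A $ i $ j) \<le> norm (endo_of_matrix A)"
proof -
  have "A $ i $ j = (A *v axis j 1) $ i"
    by (simp add: matrix_vector_mult_def axis_def if_distrib[of "\<lambda>x. _ * x"] cong: if_cong)
  then have "norm (A $ i $ j) \<le> norm (A *v axis j 1)"
    using Finite_Cartesian_Product.norm_nth_le[of "A *v axis j 1" i] by simp
  also have "\<dots> \<le> norm (endo_of_matrix A)"
    using norm_blinfun[of "blinfun_of_endo (endo_of_matrix A)" "axis j 1"]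
    by (simp add: norm_endo.rep_eq norm_Basis axis_in_Basis_iff Basis_complex_def)
  finally show ?thesis .
qed

lemma continuous_on_matrix_if_endo:
  fixes R :: "'b::topological_space \<Rightarrow> complex^'n^'n"
  assumes "continuous_on S (\<lambda>t. endo_of_matrix (R t))"
  shows "continuous_on S R"
  unfolding continuous_on_def
proof (intro ballI vec_tendstoI)
  fix s i j assume "s \<in> S"
  then have "((\<lambda>t. norm (endo_of_matrix (R t) - endo_of_matrix (R s))) \<longlongrightarrow> 0) (at s within S)"
    using assms unfolding continuous_on_def by (intro tendsto_norm_zero LIM_zero) blast
  then have "((\<lambda>t. R t $ i $ j - R s $ i $ j) \<longlongrightarrow> 0) (at s within S)"
    by (rule Lim_null_comparison[rotated])
      (use norm_matrix_entry_le[of "R _ - R s" i j] in \<open>simp add: endo_of_matrix_hom\<close>)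
  then show "((\<lambda>t. R t $ i $ j) \<longlongrightarrow> R s $ i $ j) (at s within S)"
    by (rule LIM_zero_cancel)
qed

section \<open>Scalar matrices and conjugate transposes\<close>

lemma mat_mult_commute: "mat c ** A = A ** mat (c::'a::comm_semiring_1)"
  by (simp add: vec_eq_iff matrix_matrix_mult_def mat_def mult.commute
      if_distrib[of "\<lambda>x. _ * x"] cong: if_cong)

lemma mat_mult_mat: "mat c ** mat d = (mat (c * d) :: 'a::semiring_1^'n^'n)"
  by (simp add: vec_eq_iff matrix_matrix_mult_def mat_def
      if_distrib[of "\<lambda>x. x * _"] if_distrib[of "\<lambda>x. _ * x"] cong: if_cong)

lemma bounded_linear_mat: "bounded_linear (mat :: complex \<Rightarrow> complex^'n^'n)"
  unfolding linear_conv_bounded_linear[symmetric]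
  by (simp add: linear_iff vec_eq_iff mat_def)

lemma matrix_exp_mat: "matrix_exp (mat c :: complex^'n^'n) = mat (exp c)"
proof -
  have "matrix_power (mat c :: complex^'n^'n) k = mat (c ^ k)" for k
    by (induction k) (simp_all add: mat_mult_mat)
  moreover have "(\<lambda>k. mat (c ^ k /\<^sub>R fact k) :: complex^'n^'n) sums mat (exp c)"
    by (rule bounded_linear.sums[OF bounded_linear_mat exp_converges])
  ultimately show ?thesis
    using sums_unique2[OF matrix_exp_sums[of "mat c :: complex^'n^'n"]]
    by (simp add: linear_cmul[OF bounded_linear.linear[OF bounded_linear_mat]])
qed

lemma conj_transpose_hom:
  "conj_transpose (A + B) = conj_transpose A + conj_transpose B"
  "conj_transpose (A - B) = conj_transpose A - conj_transpose B"
  "conj_transpose (r *\<^sub>R A) = r *\<^sub>R conj_transpose A"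
  "conj_transpose (mat c) = mat (cnj c)"
  by (simp_all add: conj_transpose_def map_matrix_def transpose_def vec_eq_iff mat_def)

lemma conj_transpose_mult: "conj_transpose (A ** B) = conj_transpose B ** conj_transpose A"
  by (simp add: conj_transpose_def map_matrix_def transpose_def vec_eq_iff matrix_matrix_mult_def mult.commute)

lemma bounded_linear_conj_transpose: "bounded_linear conj_transpose"
  by (simp add: linear_conv_bounded_linear[symmetric] linear_iff conj_transpose_hom)

lemma conj_transpose_matrix_exp: "conj_transpose (matrix_exp A) = matrix_exp (conj_transpose A)"
proof -
  \<comment> \<open>Conjugate transposition reverses products, so the induction produces the extra
    factor on the right, whereas \<open>matrix_power\<close> puts it on the left.\<close>
  have comm: "matrix_power B k ** B = B ** matrix_power B k" for B :: "complex^'n^'n" and k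
    by (simp add: endo_of_matrix_inject[symmetric] endo_of_matrix_hom endo_of_matrix_power power_commutes)
  have "conj_transpose (matrix_power A k) = matrix_power (conj_transpose A) k" for k
    by (induction k) (simp_all add: conj_transpose_hom conj_transpose_mult comm)
  then have "(\<lambda>k. matrix_power (conj_transpose A) k /\<^sub>R fact k) sums conj_transpose (matrix_exp A)"
    using bounded_linear.sums[OF bounded_linear_conj_transpose matrix_exp_sums[of A]]
    by (simp add: conj_transpose_hom)
  then show ?thesis
    using matrix_exp_sums by (rule sums_unique2)
qed


section \<open>Logarithms of isometries\<close>

text \<open>The hypothesis says that \<open>J\<close> intertwines \<open>conj_transpose X\<close>
  with \<open>- X\<close>, hence also their exponentials, and \<open>exp (- X)\<close> cancels
  \<open>exp X\<close>.\<close>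

lemma matrix_exp_skew_is_isometry:
  fixes X J :: "complex^'n^'n"
  assumes "conj_transpose X ** J + J ** X = 0"
  shows "invertible (matrix_exp X)" "conj_transpose (matrix_exp X) ** J ** matrix_exp X = J"
proof -
  let ?M = "endo_of_matrix :: complex^'n^'n \<Rightarrow> _"
  have inv: "exp (?M X) * exp (- ?M X) = 1" "exp (- ?M X) * exp (?M X) = 1"
    using exp_minus_inverse[of "?M X"] exp_minus_inverse[of "- ?M X"] by simp_all
  have neg: "?M (- X) = - ?M X"
    using endo_of_matrix_hom(2)[of 0 X] by (simp add: endo_of_matrix_hom)
  show "invertible (matrix_exp X)"
    unfolding invertible_def
    by (rule exI[of _ "matrix_exp (- X)"])
      (simp add: endo_of_matrix_inject[symmetric] endo_of_matrix_hom endo_of_matrix_exp neg inv)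
  have "?M (conj_transpose X) * ?M J + ?M J * ?M X = 0"
    using arg_cong[OF assms, of ?M] by (simp add: endo_of_matrix_hom)
  then have "?M (conj_transpose X) * ?M J = ?M J * (- ?M X)"
    by (simp add: eq_neg_iff_add_eq_0)
  then have "exp (?M (conj_transpose X)) * ?M J = ?M J * exp (- ?M X)"
    by (rule exp_intertwine)
  then show "conj_transpose (matrix_exp X) ** J ** matrix_exp X = J"
    by (simp add: endo_of_matrix_inject[symmetric] endo_of_matrix_hom endo_of_matrix_exp
        conj_transpose_matrix_exp mult.assoc inv)
qed

text \<open>The second hypothesis makes the resolvent exist along the whole segment from 1 to
  \<open>B\<close>, so that the integral logarithm is defined.\<close>

lemma skew_log_of_isometry:
  fixes B J :: "complex^'n^'n"
  assumes isom: "conj_transpose B ** J ** B = J"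
    and path: "\<And>t. t \<in> {0..1} \<Longrightarrow> invertible (mat 1 + t *\<^sub>R (B - mat 1))"
  obtains L where "matrix_exp L = B" "conj_transpose L ** J + J ** L = 0"
proof -
  let ?M = "endo_of_matrix :: complex^'n^'n \<Rightarrow> _"
  define P where "P t = mat 1 + t *\<^sub>R (B - mat 1)" for t
  define R where "R t = matrix_inv (P t)" for t
  define F where "F t = (B - mat 1) ** R t" for t
  define L where "L = integral {0..1} F"
  \<comment> \<open>\<open>matrix_inv\<close> is a choice of a two-sided inverse, so existence along
    the path is what justifies these equations.\<close>
  have PR: "P t ** R t = mat 1" "R t ** P t = mat 1" if "t \<in> {0..1}" for t
    using someI_ex[OF path[OF that, unfolded invertible_def], folded matrix_inv_def]
    by (simp_all add: P_def R_def)
  have MP: "?M (P t) = 1 + t *\<^sub>R (?M B - 1)" for t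
    by (simp add: P_def endo_of_matrix_hom)
  have MPR: "?M (P t) * ?M (R t) = 1" "?M (R t) * ?M (P t) = 1" if "t \<in> {0..1}" for t
    using PR[OF that, THEN arg_cong[of _ _ ?M]] by (simp_all add: endo_of_matrix_hom)
  have MF: "?M (F t) = (?M B - 1) * ?M (R t)" for t
    by (simp add: F_def endo_of_matrix_hom)
  have "continuous_on {0..1} (\<lambda>t. ?M (R t))"
    by (rule continuous_on_inverse_banach_algebra[of _ "\<lambda>t. ?M (P t)"])
      (auto simp: MP intro!: continuous_intros MPR[unfolded MP])
  then have "continuous_on {0..1} F"
    by (intro continuous_on_matrix_if_endo) (auto simp: MF intro!: continuous_intros)
  then have F: "F integrable_on {0..1}"
    by (rule integrable_continuous_real)
  \<comment> \<open>The integral is formed among matrices; a bounded linear map carries it to the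
    operator integral.\<close>
  have "?M (matrix_exp L) = exp (integral {0..1} (\<lambda>t. (?M B - 1) * ?M (R t)))"
    using integral_linear[OF F bounded_linear_endo_of_matrix]
    by (simp add: endo_of_matrix_exp L_def o_def MF)
  also have "\<dots> = ?M B"
    by (rule exp_integral_resolvent) (use MPR in \<open>simp_all add: MP\<close>)
  finally have exp_L: "matrix_exp L = B"
    by (simp add: endo_of_matrix_inject)
  have skew: "conj_transpose (F t) ** J + J ** F (1 - t) = 0" if t: "t \<in> {0..1}" for t
  proof -
    define b b' j r r' where "b = ?M B" and "b' = ?M (conj_transpose B)" and "j = ?M J"
      and "r = ?M (R (1 - t))" and "r' = ?M (conj_transpose (R t))"
    note defs = b_def b'_def j_def r_def r'_def
    have isom': "b' * (j * b) = j"
      using arg_cong[OF isom, of ?M] by (simp add: defs endo_of_matrix_hom mult.assoc)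
    have pr: "(1 + (1 - t) *\<^sub>R (b - 1)) * r = 1"
      using MPR(1)[of "1 - t"] t by (simp add: defs MP)
    have rp: "r' * (1 + t *\<^sub>R (b' - 1)) = 1"
      using arg_cong[OF PR(1)[OF t], of "\<lambda>A. ?M (conj_transpose A)"]
      by (simp add: defs P_def conj_transpose_hom conj_transpose_mult endo_of_matrix_hom)
    \<comment> \<open>The claim with its inverses cleared: multiplied by the adjoint of
      \<open>P t\<close> on the left and by \<open>P (1 - t)\<close> on the right. The weights
      \<open>t\<close> and \<open>1 - t\<close> add up to 1, leaving
      \<open>b' * j * b - j\<close>.\<close>
    have "(b' - 1) * j * (1 + (1 - t) *\<^sub>R (b - 1)) + (1 + t *\<^sub>R (b' - 1)) * j * (b - 1) = 0"
      by (simp add: algebra_simps isom')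
    then have "0 = r' * ((b' - 1) * j * (1 + (1 - t) *\<^sub>R (b - 1)) + (1 + t *\<^sub>R (b' - 1)) * j * (b - 1)) * r"
      by simp
    also have "\<dots> = r' * ((b' - 1) * j) * ((1 + (1 - t) *\<^sub>R (b - 1)) * r)
        + (r' * (1 + t *\<^sub>R (b' - 1))) * j * (b - 1) * r"
    proof -
      have "r' * (x * p + q * j * y) * r = r' * x * (p * r) + (r' * q) * j * y * r" for x y p q
        by (simp add: algebra_simps)
      then show ?thesis .
    qed
    also have "\<dots> = r' * ((b' - 1) * j) + j * (b - 1) * r"
      by (simp only: pr rp mult_1_left mult_1_right)
    finally show ?thesis
      by (simp add: endo_of_matrix_inject[symmetric] endo_of_matrix_hom F_def conj_transpose_mult
          conj_transpose_hom defs mult.assoc)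
  qed
  have lin1: "bounded_linear (\<lambda>A :: complex^'n^'n. conj_transpose A ** J)"
    unfolding linear_conv_bounded_linear[symmetric]
    by (simp add: linear_iff endo_of_matrix_inject[symmetric] endo_of_matrix_hom conj_transpose_hom algebra_simps)
  have lin2: "bounded_linear (\<lambda>A :: complex^'n^'n. J ** A)"
    unfolding linear_conv_bounded_linear[symmetric]
    by (simp add: linear_iff endo_of_matrix_inject[symmetric] endo_of_matrix_hom algebra_simps)
  have "(F has_integral L) {0..1}"
    using F by (simp add: L_def has_integral_integral)
  \<comment> \<open>The reflection of the unit interval preserves the integral, so both terms of the
    skew relation integrate to expressions in the same \<open>L\<close>.\<close>
  from has_integral_affinity01[OF this, of "-1" 1]
  have "((\<lambda>t. F (1 - t)) has_integral L) {0..1}"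
    by simp
  from has_integral_linear[OF this lin2]
  have "((\<lambda>t. J ** F (1 - t)) has_integral J ** L) {0..1}"
    by (simp add: o_def)
  moreover from has_integral_linear[OF \<open>(F has_integral L) {0..1}\<close> lin1]
  have "((\<lambda>t. conj_transpose (F t) ** J) has_integral conj_transpose L ** J) {0..1}"
    by (simp add: o_def)
  ultimately have "((\<lambda>t. conj_transpose (F t) ** J + J ** F (1 - t)) has_integral
      conj_transpose L ** J + J ** L) {0..1}"
    by (rule has_integral_add[rotated])
  then have "((\<lambda>t::real. 0) has_integral conj_transpose L ** J + J ** L) {0..1}"
    by (rule has_integral_eq[rotated]) (rule skew)
  then have "conj_transpose L ** J + J ** L = 0"
    by (simp add: has_integral_0_eq)
  with exp_L that show thesis
    by blast
qed

section \<open>Rotating the spectrum off the negative real axis\<close>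

lemma finite_spectrum_of_invertible:
  fixes A :: "complex^'n^'n"
  assumes "invertible A"
  shows "finite {z. \<not> invertible (A - mat z)}"
proof -
  \<comment> \<open>The characteristic polynomial up to sign, as a determinant of linear
    polynomials; evaluation commutes with the Leibniz formula. It is nonzero because its value at 0
    is \<open>det A\<close>.\<close>
  define p where "p = det (\<chi> i j. [:A $ i $ j, - (mat 1 :: complex^'n^'n) $ i $ j:])"
  have p: "poly p z = det (A - mat z)" for z
  proof -
    have "poly [:A $ i $ j, - (mat 1 :: complex^'n^'n) $ i $ j:] z = (A - mat z) $ i $ j" for i j
      by (simp add: mat_def)
    then show ?thesis
      unfolding p_def det_def by (simp only: poly_sum poly_mult poly_prod poly_of_int vec_lambda_beta)
  qed
  have "poly p 0 \<noteq> 0"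
    using assms by (simp add: p invertible_det_nz mat_0)
  then have "p \<noteq> 0"
    by auto
  then have "finite {z. poly p z = 0}"
    by (rule poly_roots_finite)
  then show ?thesis
    by (simp add: p invertible_det_nz)
qed

lemma invertible_mat:
  "c \<noteq> 0 \<Longrightarrow> invertible (mat c :: 'a::field^'n^'n)"
  unfolding invertible_def by (rule exI[of _ "mat (inverse c)"]) (simp add: mat_mult_mat)

text \<open>For \<open>t \<noteq> 0\<close> the matrix is \<open>t * cis \<theta>\<close> times
  \<open>A - mat z\<close> with \<open>z = - ((1 - t) / t) * cnj (cis \<theta>)\<close>. A nonzero
  eigenvalue \<open>z\<close> of this shape forces \<open>cis \<theta> = - cnj (sgn z)\<close>, so
  only finitely many rotations are bad.\<close>

lemma rotation_avoids_negative_reals: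
  fixes A :: "complex^'n^'n"
  assumes A: "invertible A"
  obtains \<theta> where "\<And>t. t \<in> {0..1} \<Longrightarrow> invertible (mat 1 + t *\<^sub>R (mat (cis \<theta>) ** A - mat 1))"
proof -
  define Z where "Z = {z. \<not> invertible (A - mat z)}"
  \<comment> \<open>On the half circle the real part already determines the angle; this supplies
    infinitely many candidate rotations.\<close>
  have "inj_on cis {0..pi}"
    by (rule inj_onI) (auto simp: complex_eq_iff intro: cos_inj_pi)
  moreover have "infinite {0..pi}"
    by (simp add: infinite_Icc)
  moreover have "finite ((\<lambda>z. - cnj (sgn z)) ` Z)"
    unfolding Z_def by (intro finite_imageI finite_spectrum_of_invertible A)
  ultimately have "\<not> cis ` {0..pi} \<subseteq> (\<lambda>z. - cnj (sgn z)) ` Z"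
    by (meson finite_imageD finite_subset)
  then obtain \<theta> where \<theta>: "cis \<theta> \<notin> (\<lambda>z. - cnj (sgn z)) ` Z"
    by blast
  show thesis
  proof (rule that)
    fix t :: real assume t: "t \<in> {0..1}"
    show "invertible (mat 1 + t *\<^sub>R (mat (cis \<theta>) ** A - mat 1))"
    proof (cases "t = 0")
      case True
      then show ?thesis
        using invertible_mat[of 1] by simp
    next
      case False
      define s where "s = (1 - t) / t"
      define z where "z = - (s *\<^sub>R cnj (cis \<theta>))"
      have s: "s \<ge> 0"
        using t False by (simp add: s_def)
      have "z \<notin> Z"
      \<comment> \<open>Here \<open>s = 0\<close> means \<open>t = 1\<close> and
        \<open>z = 0\<close>, which is no eigenvalue since \<open>A\<close> is invertible.\<close>
      proof (cases "s = 0")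
        case True
        then show ?thesis
          using A by (simp add: z_def Z_def mat_0)
      next
        case False
        then have "sgn z = - cnj (cis \<theta>)"
          using s by (simp add: z_def sgn_minus sgn_scaleR sgn_div_norm)
        then have "cis \<theta> = - cnj (sgn z)"
          by simp
        then show ?thesis
          using \<theta> by blast
      qed
      then have "invertible (mat (t *\<^sub>R cis \<theta>) ** (A - mat z))"
        using False by (intro invertible_mult invertible_mat) (auto simp: Z_def)
      moreover have "mat (t *\<^sub>R cis \<theta>) ** (A - mat z) = mat 1 + t *\<^sub>R (mat (cis \<theta>) ** A - mat 1)"
      proof -
        have "(t *\<^sub>R cis \<theta>) * z = - ((t * s) *\<^sub>R (cis \<theta> * cnj (cis \<theta>)))"
          by (simp add: z_def)
        also have "\<dots> = of_real (t - 1)"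
          using False by (simp add: s_def cis_cnj cis_mult scaleR_conv_of_real)
        finally have "(t *\<^sub>R cis \<theta>) * z = of_real (t - 1)" .
        then have "mat (t *\<^sub>R cis \<theta>) ** mat z = (t - 1) *\<^sub>R (mat 1 :: complex^'n^'n)"
          by (simp only: mat_mult_mat) (simp add: mat_def vec_eq_iff of_real_def)
        moreover have "mat (t *\<^sub>R cis \<theta>) = (t *\<^sub>R mat (cis \<theta>) :: complex^'n^'n)"
          by (simp add: mat_def vec_eq_iff)
        ultimately show ?thesis
          by (simp add: endo_of_matrix_inject[symmetric] endo_of_matrix_hom algebra_simps)
      qed
      ultimately show ?thesis
        by simp
    qed
  qed
qed

section \<open>The exponential image of the Lie algebra\<close>

theorem corollary5p2p1:
  shows "matrix_exp ` (indefinite_unitary_algebra :: (complex^('p::finite + 'q::finite)^('p + 'q)) set)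
    = indefinite_unitary_group"
proof (intro subset_antisym subsetI)
  \<comment> \<open>This inclusion says that the exponential maps the Lie algebra into the group;
    the reverse one is surjectivity.\<close>
  fix A :: "complex^('p + 'q)^('p + 'q)"
  assume "A \<in> matrix_exp ` indefinite_unitary_algebra"
  then show "A \<in> indefinite_unitary_group"
    using matrix_exp_skew_is_isometry
    by (auto simp: indefinite_unitary_algebra_def indefinite_unitary_group_def)
next
  let ?M = "endo_of_matrix :: complex^('p + 'q)^('p + 'q) \<Rightarrow> _"
  let ?J = "signature_matrix :: complex^('p + 'q)^('p + 'q)"
  fix A :: "complex^('p + 'q)^('p + 'q)"
  assume "A \<in> indefinite_unitary_group"
  then have A: "invertible A" and isom: "conj_transpose A ** ?J ** A = ?J"
    by (simp_all add: indefinite_unitary_group_def)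
  obtain \<theta> where path: "\<And>t. t \<in> {0..1} \<Longrightarrow> invertible (mat 1 + t *\<^sub>R (mat (cis \<theta>) ** A - mat 1))"
    using rotation_avoids_negative_reals[OF A] by blast
  \<comment> \<open>The rotated matrix is again an isometry: the scalars move to the front, where
    \<open>cnj (cis \<theta>) * cis \<theta> = 1\<close>.\<close>
  have "conj_transpose (mat (cis \<theta>) ** A) ** ?J ** (mat (cis \<theta>) ** A)
      = (conj_transpose A ** mat (cnj (cis \<theta>))) ** ((?J ** mat (cis \<theta>)) ** A)"
    by (simp only: conj_transpose_mult conj_transpose_hom matrix_mul_assoc)
  also have "\<dots> = (mat (cnj (cis \<theta>)) ** conj_transpose A) ** ((mat (cis \<theta>) ** ?J) ** A)"
    by (simp only: mat_mult_commute[of "cis \<theta>" ?J] mat_mult_commute[of "cnj (cis \<theta>)" "conj_transpose A"])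
  also have "\<dots> = mat (cnj (cis \<theta>)) ** (conj_transpose A ** mat (cis \<theta>)) ** (?J ** A)"
    by (simp only: matrix_mul_assoc)
  also have "\<dots> = mat (cnj (cis \<theta>)) ** (mat (cis \<theta>) ** conj_transpose A) ** (?J ** A)"
    by (simp only: mat_mult_commute[of "cis \<theta>" "conj_transpose A"])
  also have "\<dots> = (mat (cnj (cis \<theta>)) ** mat (cis \<theta>)) ** (conj_transpose A ** ?J ** A)"
    by (simp only: matrix_mul_assoc)
  also have "\<dots> = ?J"
    by (simp add: isom mat_mult_mat cis_cnj cis_mult)
  finally obtain L where L: "matrix_exp L = mat (cis \<theta>) ** A" "conj_transpose L ** ?J + ?J ** L = 0"
    using skew_log_of_isometry path by blast
  \<comment> \<open>Undoes the rotation: the scalar is central, so \<open>exp\<close> splits and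
    contributes the factor \<open>cis (- \<theta>)\<close>.\<close>
  define X where "X = L - mat (\<i> * \<theta>)"
  have comm: "?M (mat c) * ?M B = ?M B * ?M (mat c)" for c B
    unfolding endo_of_matrix_hom(3)[symmetric] by (rule arg_cong, rule mat_mult_commute)
  have "?M (matrix_exp X) = exp (?M (mat (- (\<i> * \<theta>))) + ?M L)"
  proof -
    have "X = mat (- (\<i> * \<theta>)) + L"
      by (simp add: X_def vec_eq_iff mat_def)
    then show ?thesis
      by (simp add: endo_of_matrix_exp endo_of_matrix_hom)
  qed
  also have "\<dots> = ?M (mat (exp (- (\<i> * \<theta>)))) * ?M (mat (cis \<theta>) ** A)"
    by (simp only: exp_add_commuting[OF comm] endo_of_matrix_exp[symmetric] matrix_exp_mat L)
  also have "\<dots> = ?M A"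
    by (simp add: endo_of_matrix_hom(3)[symmetric] matrix_mul_assoc mat_mult_mat cis_conv_exp exp_minus)
  finally have "matrix_exp X = A"
    by (simp add: endo_of_matrix_inject)
  moreover have "conj_transpose X ** ?J + ?J ** X = 0"
  proof -
    \<comment> \<open>The sign flips because \<open>\<i> * \<theta>\<close> is purely imaginary; the
      two scalar terms then cancel across \<open>?J\<close>.\<close>
    have "conj_transpose X = conj_transpose L + mat (\<i> * \<theta>)"
      by (simp add: X_def conj_transpose_hom) (simp add: vec_eq_iff mat_def)
    moreover have "?M (conj_transpose L) * ?M ?J + ?M ?J * ?M L = 0"
      using arg_cong[OF L(2), of ?M] by (simp add: endo_of_matrix_hom)
    ultimately have "?M (conj_transpose X ** ?J + ?J ** X) = 0"
      using comm[of "\<i> * \<theta>" ?J] by (simp add: X_def endo_of_matrix_hom algebra_simps)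
    then show ?thesis
      by (simp add: endo_of_matrix_inject[symmetric] endo_of_matrix_hom)
  qed
  ultimately show "A \<in> matrix_exp ` indefinite_unitary_algebra"
    by (auto simp: indefinite_unitary_algebra_def)
qed

end
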